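(* Let $A$ be a finite alphabet, let $S\subseteq A^*$ be a recurrent neutral set, let $X\subseteq S$ be a finite $S$-maximal bifix code, and let $f:B^*\to A^*$ be a coding morphism for $X$. Then $f^{-1}(S)\subseteq B^*$ is a neutral set and $\chi(f^{-1}(S))=\chi(S)$.
   Context: A set $S\subseteq A^*$ is factorial if it contains all factors of its elements. For $w\in S$: $\ell_S(w)=\mathrm{Card}\{a\in A: aw\in S\}$, $r_S(w)=\mathrm{Card}\{a\in A: wa\in S\}$, $e_S(w)=\mathrm{Card}\{(a,b)\in A\times A: awb\in S\}$, $m_S(w)=e_S(w)-\ell_S(w)-r_S(w)+1$ (and analogously for subsets of $B^*$ with letters of $B$). A set is neutral if it is factorial and $m(w)=0$ for every nonempty word $w$ in it; its characteristic is $\chi=1-m(\varepsilon)$. $S\neq\{\varepsilon\}$ is recurrent if it is factorial and for all $u,w\in S$ there is $v\in S$ with $uvw\in S$. A bifix code is a set of nonempty words none of which is a proper prefix or proper suffix of another; a bifix code $X\subseteq S$ is $S$-maximal if it is not properly contained in a bifix code $Y\subseteq S$. A coding morphism for $X$ is a monoid morphism $f:B^*\to A^*$ mapping an alphabet $B$ bijectively onto $X$. *)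

theory Defs
  imports Main "HOL-Library.Sublist"
begin

text \<open>
  A word over the alphabet \<open>A\<close> is an element of \<open>lists A\<close>, and \<open>[]\<close> is the empty word.
  The counting functions below agree with the intended cardinalities only for finite \<open>A\<close>.
\<close>

definition factorial :: "'a list set \<Rightarrow> bool" where
  "factorial S \<longleftrightarrow> (\<forall>w\<in>S. \<forall>u. sublist u w \<longrightarrow> u \<in> S)"

definition left_ext_card :: "'a set \<Rightarrow> 'a list set \<Rightarrow> 'a list \<Rightarrow> nat" where
  "left_ext_card A S w = card {a \<in> A. [a] @ w \<in> S}"

definition right_ext_card :: "'a set \<Rightarrow> 'a list set \<Rightarrow> 'a list \<Rightarrow> nat" where
  "right_ext_card A S w = card {a \<in> A. w @ [a] \<in> S}"

definition bi_ext_card :: "'a set \<Rightarrow> 'a list set \<Rightarrow> 'a list \<Rightarrow> nat" where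
  "bi_ext_card A S w = card {(a, b) \<in> A \<times> A. [a] @ w @ [b] \<in> S}"

definition word_mult :: "'a set \<Rightarrow> 'a list set \<Rightarrow> 'a list \<Rightarrow> int" where
  "word_mult A S w =
     int (bi_ext_card A S w) - int (left_ext_card A S w) - int (right_ext_card A S w) + 1"

definition neutral :: "'a set \<Rightarrow> 'a list set \<Rightarrow> bool" where
  "neutral A S \<longleftrightarrow> S \<subseteq> lists A \<and> factorial S \<and> (\<forall>w\<in>S. w \<noteq> [] \<longrightarrow> word_mult A S w = 0)"

definition characteristic :: "'a set \<Rightarrow> 'a list set \<Rightarrow> int" where
  "characteristic A S = 1 - word_mult A S []"

definition recurrent :: "'a list set \<Rightarrow> bool" where
  "recurrent S \<longleftrightarrow> S \<noteq> {[]} \<and> factorial S \<and> (\<forall>u\<in>S. \<forall>w\<in>S. \<exists>v\<in>S. u @ v @ w \<in> S)"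

definition bifix_code :: "'a list set \<Rightarrow> bool" where
  "bifix_code X \<longleftrightarrow>
     [] \<notin> X \<and> (\<forall>x\<in>X. \<forall>y\<in>X. \<not> strict_prefix x y \<and> \<not> strict_suffix x y)"

definition maximal_bifix_code_in :: "'a list set \<Rightarrow> 'a list set \<Rightarrow> bool" where
  "maximal_bifix_code_in S X \<longleftrightarrow>
     X \<subseteq> S \<and> bifix_code X \<and> \<not> (\<exists>Y. Y \<subseteq> S \<and> bifix_code Y \<and> X \<subset> Y)"

definition word_morphism :: "'b set \<Rightarrow> 'a set \<Rightarrow> ('b list \<Rightarrow> 'a list) \<Rightarrow> bool" where
  "word_morphism B A f \<longleftrightarrow>
     f ` lists B \<subseteq> lists A \<and> f [] = [] \<and>
     (\<forall>u\<in>lists B. \<forall>v\<in>lists B. f (u @ v) = f u @ f v)"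

definition coding_morphism ::
  "'b set \<Rightarrow> 'a set \<Rightarrow> 'a list set \<Rightarrow> ('b list \<Rightarrow> 'a list) \<Rightarrow> bool" where
  "coding_morphism B A X f \<longleftrightarrow> word_morphism B A f \<and> bij_betw (\<lambda>b. f [b]) B X"

end

theory Submission
  imports Defs
begin

text \<open>
  Two ideas. First, a finite \<open>S\<close>-maximal bifix code \<open>X\<close> is complete on both sides: the number of
  parses of a word \<open>w\<close> by \<open>X\<close> is the number of prefixes of \<open>w\<close> without suffix in \<open>X\<close> and also the
  number of suffixes of \<open>w\<close> without prefix in \<open>X\<close>. If every word of \<open>S\<close> is suffix-comparable with
  \<open>X\<close>, the first number is bounded on \<open>S\<close>; if some \<open>u \<in> S\<close> is not prefix-comparable with \<open>X\<close>, then
  words \<open>u v\<^sub>1 u v\<^sub>2 \<dots> u\<close> of \<open>S\<close> make the second one unbounded. If completeness fails on both sides,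
  recurrence yields a word of \<open>S\<close> that can be added to \<open>X\<close>.

  Second, in the multiplicity of \<open>w\<close> the letters may be replaced on either side by a finite complete
  code: for fixed left extensions, the function \<open>\<phi> v = (number of left extensions of w v) - [w v \<in> S]\<close>
  satisfies \<open>\<phi> v = (\<Sum>a\<in>A. \<phi> (v a))\<close> for nonempty \<open>v\<close> by neutrality, so that its sum over a complete
  prefix code equals its sum over the letters.
\<close>

section \<open>Completeness of finite maximal bifix codes\<close>

definition prefix_code :: "'a list set \<Rightarrow> bool" where
  "prefix_code X \<longleftrightarrow> (\<forall>x\<in>X. \<forall>y\<in>X. prefix x y \<longrightarrow> x = y)"

text \<open>Suffix completeness is expressed as \<open>prefix_complete\<close> of the reversed sets,
  so that one-sided results carry over by reversal.\<close>

definition prefix_complete :: "'a list set \<Rightarrow> 'a list set \<Rightarrow> bool" where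
  "prefix_complete S X \<longleftrightarrow> (\<forall>w\<in>S. \<exists>x\<in>X. prefix x w \<or> prefix w x)"

definition prefix_free_of :: "'a list set \<Rightarrow> 'a list \<Rightarrow> bool" where
  "prefix_free_of X p \<longleftrightarrow> (\<forall>x\<in>X. \<not> prefix x p)"

definition suffix_free_of :: "'a list set \<Rightarrow> 'a list \<Rightarrow> bool" where
  "suffix_free_of X s \<longleftrightarrow> (\<forall>x\<in>X. \<not> suffix x s)"

lemma rev_image_mem_iff: "w \<in> rev ` S \<longleftrightarrow> rev w \<in> S"
  by (metis image_iff rev_rev_ident)

lemma prefix_complete_rev_iff:
  "prefix_complete (rev ` S) (rev ` X) \<longleftrightarrow> (\<forall>w\<in>S. \<exists>x\<in>X. suffix x w \<or> suffix w x)"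
  by (simp add: prefix_complete_def suffix_to_prefix)

lemma bifix_code_rev: "bifix_code X \<Longrightarrow> bifix_code (rev ` X)"
  by (auto simp: bifix_code_def strict_prefix_def strict_suffix_def suffix_to_prefix)

lemma bifix_code_imp_prefix_code: "bifix_code X \<Longrightarrow> prefix_code X"
  by (auto simp: bifix_code_def prefix_code_def strict_prefix_def)

lemma factorial_rev:
  assumes "factorial S"
  shows "factorial (rev ` S)"
  unfolding factorial_def
proof (intro ballI allI impI)
  fix w u assume "w \<in> rev ` S" "sublist u w"
  then have "rev w \<in> S" "sublist (rev u) (rev w)"
    by (simp_all add: rev_image_mem_iff)
  then show "u \<in> rev ` S"
    using assms by (auto simp: factorial_def rev_image_mem_iff)
qed

lemma recurrent_rev:
  assumes "recurrent S"
  shows "recurrent (rev ` S)"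
  unfolding recurrent_def
proof (intro conjI ballI)
  show "rev ` S \<noteq> {[]}"
  proof
    assume "rev ` S = {[]}"
    then have "rev ` rev ` S = {[]}" by simp
    then show False using assms by (simp add: image_image recurrent_def)
  qed
  show "factorial (rev ` S)"
    using assms by (simp add: recurrent_def factorial_rev)
  fix u w assume "u \<in> rev ` S" "w \<in> rev ` S"
  then obtain v where "v \<in> S" "rev w @ v @ rev u \<in> S"
    using assms by (metis recurrent_def rev_image_mem_iff)
  then have "rev v \<in> rev ` S" "u @ rev v @ w \<in> rev ` S"
    by (simp_all add: rev_image_mem_iff)
  then show "\<exists>v\<in>rev ` S. u @ v @ w \<in> rev ` S" by blast
qed

text \<open>Reading from the left, a prefix code leaves no choice of the next code word, and neither
  reading can stop while the other continues, since no remainder has a prefix in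
  \<open>X\<close>.\<close>

lemma parse_remainder_unique:
  assumes "prefix_code X" "set xs \<subseteq> X" "set ys \<subseteq> X"
    and "prefix_free_of X p" "prefix_free_of X q"
    and "concat xs @ p = concat ys @ q"
  shows "p = q"
  using assms(2,3,6)
proof (induction xs arbitrary: ys)
  case Nil
  then show ?case
    using assms(4) by (cases ys) (auto simp: prefix_free_of_def)
next
  case (Cons x xs)
  show ?case
  proof (cases ys)
    case Nil
    then show ?thesis
      using Cons.prems assms(5) by (auto simp: prefix_free_of_def prefix_def)
  next
    case (Cons y ys')
    have eq: "x @ concat xs @ p = y @ concat ys' @ q"
      using Cons Cons.prems by simp
    then have "prefix x y \<or> prefix y x"
      by (metis prefixI prefix_same_cases)
    then have "x = y"
      using Cons.prems Cons assms(1) by (auto simp: prefix_code_def)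
    then show ?thesis
      using Cons.IH[of ys'] Cons.prems Cons eq by simp
  qed
qed

text \<open>Code words are stripped off the right end as long as possible; each is nonempty, so this
  stops.\<close>

lemma exists_parse:
  assumes "[] \<notin> X"
  shows "\<exists>s xs. set xs \<subseteq> X \<and> w = s @ concat xs \<and> suffix_free_of X s"
proof (induction w rule: length_induct)
  case (1 w)
  show ?case
  proof (cases "suffix_free_of X w")
    case True
    then show ?thesis by (intro exI[of _ w] exI[of _ "[]"]) simp
  next
    case False
    then obtain x t where x: "x \<in> X" "w = t @ x"
      by (auto simp: suffix_free_of_def suffix_def)
    then have "length t < length w"
      using assms by (cases x) auto
    then obtain s xs where "set xs \<subseteq> X" "t = s @ concat xs" "suffix_free_of X s"
      using 1 by blast
    then show ?thesis
      using x by (intro exI[of _ s] exI[of _ "xs @ [x]"]) simp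
  qed
qed

lemma finite_prefixes: "finite {s. prefix s w \<and> P s}"
  by (rule finite_subset[of _ "set (prefixes w)"]) auto

lemma finite_suffixes: "finite {s. suffix s w \<and> P s}"
  by (rule finite_subset[of _ "set (suffixes w)"]) auto

text \<open>The relation sends \<open>p\<close> to the first component \<open>s\<close> of a parse \<open>w = s x p\<close> with \<open>x \<in> X\<^sup>*\<close>.\<close>

lemma card_prefix_free_suffixes_le:
  assumes "prefix_code X" "[] \<notin> X"
  shows "card {p. suffix p w \<and> prefix_free_of X p} \<le> card {s. prefix s w \<and> suffix_free_of X s}"
proof (rule card_le_if_inj_on_rel[where r = "\<lambda>p s. \<exists>xs. set xs \<subseteq> X \<and> w = s @ concat xs @ p"])
  show "finite {s. prefix s w \<and> suffix_free_of X s}"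
    by (rule finite_prefixes)
next
  fix p assume "p \<in> {p. suffix p w \<and> prefix_free_of X p}"
  then obtain t where "w = t @ p"
    by (auto simp: suffix_def)
  moreover obtain s xs where "set xs \<subseteq> X" "t = s @ concat xs" "suffix_free_of X s"
    using exists_parse[OF assms(2)] by blast
  ultimately have "s \<in> {s. prefix s w \<and> suffix_free_of X s}"
      "set xs \<subseteq> X \<and> w = s @ concat xs @ p"
    by auto
  then show "\<exists>s. s \<in> {s. prefix s w \<and> suffix_free_of X s} \<and>
      (\<exists>xs. set xs \<subseteq> X \<and> w = s @ concat xs @ p)"
    by blast
next
  fix p q s
  assume "p \<in> {p. suffix p w \<and> prefix_free_of X p}" "q \<in> {p. suffix p w \<and> prefix_free_of X p}"
    and "\<exists>xs. set xs \<subseteq> X \<and> w = s @ concat xs @ p" "\<exists>xs. set xs \<subseteq> X \<and> w = s @ concat xs @ q"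
  then show "p = q"
    using parse_remainder_unique[OF assms(1)] by (metis mem_Collect_eq same_append_eq)
qed

text \<open>By completeness a suffix-free \<open>s\<close> is a proper suffix of a code word, hence
  shorter than \<open>n\<close>; a prefix of \<open>w\<close> is determined by its length, one of
  \<open>0, ..., n - 1\<close>.\<close>

lemma card_suffix_free_prefixes_le:
  assumes "factorial S" "prefix_complete (rev ` S) (rev ` X)" "w \<in> S"
    and "\<And>x. x \<in> X \<Longrightarrow> length x \<le> n"
  shows "card {s. prefix s w \<and> suffix_free_of X s} \<le> n"
proof -
  have "{s. prefix s w \<and> suffix_free_of X s} \<subseteq> (\<lambda>i. take i w) ` {..<n}"
  proof
    fix s assume "s \<in> {s. prefix s w \<and> suffix_free_of X s}"
    then have s: "prefix s w" "suffix_free_of X s" by auto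
    then have "s \<in> S"
      using assms(1,3) by (auto simp: factorial_def dest: prefix_imp_sublist)
    then obtain x where x: "x \<in> X" "suffix s x" "\<not> suffix x s"
      using assms(2) s(2) unfolding prefix_complete_rev_iff suffix_free_of_def by blast
    then obtain t where "x = t @ s" by (auto simp: suffix_def)
    then have "length s < length x" using x(3) by (cases t) auto
    then have "length s < n" using assms(4)[OF x(1)] by linarith
    moreover have "s = take (length s) w"
      using s(1) by (auto simp: prefix_def)
    ultimately show "s \<in> (\<lambda>i. take i w) ` {..<n}" by blast
  qed
  then have "card {s. prefix s w \<and> suffix_free_of X s} \<le> card ((\<lambda>i. take i w) ` {..<n})"
    by (intro card_mono) auto
  also have "\<dots> \<le> n"
    using card_image_le[of "{..<n}" "\<lambda>i. take i w"] by simp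
  finally show ?thesis .
qed

text \<open>Prepending \<open>u @ v\<close> to \<open>w\<close> keeps the prefix-free suffixes of
  \<open>w\<close> and adds the whole new word: a code word at its start would be comparable with
  \<open>u\<close>.\<close>

lemma many_prefix_free_suffixes:
  assumes "recurrent S" "u \<in> S" "u \<noteq> []" "\<forall>x\<in>X. \<not> prefix x u \<and> \<not> prefix u x"
  shows "\<exists>w\<in>S. k \<le> card {p. suffix p w \<and> prefix_free_of X p}"
proof (induction k)
  case 0
  then show ?case using assms(2) by blast
next
  case (Suc k)
  then obtain w where w: "w \<in> S" "k \<le> card {p. suffix p w \<and> prefix_free_of X p}" by blast
  obtain v where v: "u @ v @ w \<in> S"
    using assms(1,2) w(1) by (auto simp: recurrent_def)
  have "prefix_free_of X (u @ v @ w)"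
    using assms(4) by (metis prefix_free_of_def prefixI prefix_same_cases)
  then have sub: "insert (u @ v @ w) {p. suffix p w \<and> prefix_free_of X p}
      \<subseteq> {p. suffix p (u @ v @ w) \<and> prefix_free_of X p}"
    by (auto simp: suffix_def)
  have new: "u @ v @ w \<notin> {p. suffix p w \<and> prefix_free_of X p}"
    using assms(3) by (auto dest: suffix_length_le)
  have "Suc k \<le> card (insert (u @ v @ w) {p. suffix p w \<and> prefix_free_of X p})"
    using w(2) new by (simp add: finite_suffixes)
  also have "\<dots> \<le> card {p. suffix p (u @ v @ w) \<and> prefix_free_of X p}"
    using sub by (intro card_mono finite_suffixes)
  finally show ?case using v by blast
qed

lemma suffix_complete_imp_prefix_complete:
  assumes "recurrent S" "finite X" "bifix_code X" "prefix_complete (rev ` S) (rev ` X)"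
  shows "prefix_complete S X"
proof (rule ccontr)
  assume "\<not> prefix_complete S X"
  then obtain u where u: "u \<in> S" "\<forall>x\<in>X. \<not> prefix x u \<and> \<not> prefix u x"
    by (auto simp: prefix_complete_def)
  \<comment> \<open>The empty word is a prefix of any element of \<open>X\<close>, so one such
    element shows that \<open>u\<close> is not empty.\<close>
  obtain x where "x \<in> X"
    using assms(4) u(1) by (auto simp: prefix_complete_rev_iff)
  then have "u \<noteq> []" using u(2) by auto
  obtain n where n: "\<And>x. x \<in> X \<Longrightarrow> length x \<le> n"
    using assms(2) by (metis finite_imageI finite_nat_set_iff_bounded_le imageI)
  obtain w where w: "w \<in> S" "Suc n \<le> card {p. suffix p w \<and> prefix_free_of X p}"
    using many_prefix_free_suffixes[OF assms(1) u(1) \<open>u \<noteq> []\<close> u(2)] by blast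
  note w(2)
  also have "card {p. suffix p w \<and> prefix_free_of X p} \<le> card {s. prefix s w \<and> suffix_free_of X s}"
    using assms(3) by (intro card_prefix_free_suffixes_le bifix_code_imp_prefix_code)
      (auto simp: bifix_code_def)
  also have "\<dots> \<le> n"
    using assms(1,4) w(1) n by (intro card_suffix_free_prefixes_le) (auto simp: recurrent_def)
  finally show False by simp
qed

lemma maximal_bifix_code_prefix_or_suffix_complete:
  assumes "recurrent S" "maximal_bifix_code_in S X"
  shows "prefix_complete S X \<or> prefix_complete (rev ` S) (rev ` X)"
proof (rule ccontr)
  have X: "X \<subseteq> S" "bifix_code X" "\<And>Y. Y \<subseteq> S \<Longrightarrow> bifix_code Y \<Longrightarrow> \<not> X \<subset> Y"
    using assms(2) by (auto simp: maximal_bifix_code_in_def)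
  assume "\<not> (prefix_complete S X \<or> prefix_complete (rev ` S) (rev ` X))"
  then obtain u w where u: "u \<in> S" "\<forall>x\<in>X. \<not> prefix x u \<and> \<not> prefix u x"
    and w: "w \<in> S" "\<forall>x\<in>X. \<not> suffix x w \<and> \<not> suffix w x"
    unfolding prefix_complete_rev_iff unfolding prefix_complete_def by blast
  \<comment> \<open>If \<open>X\<close> is empty, any nonempty word of \<open>S\<close> will do.
    Otherwise \<open>u @ v @ w\<close> works: a code word comparable with it as a prefix would be
    comparable with \<open>u\<close>, and as a suffix with \<open>w\<close>.\<close>
  obtain y where y: "y \<in> S" "y \<noteq> []"
    "\<forall>x\<in>X. \<not> prefix x y \<and> \<not> prefix y x \<and> \<not> suffix x y \<and> \<not> suffix y x"
  proof (cases "X = {}")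
    case True
    then show ?thesis
      using that u(1) assms(1) unfolding recurrent_def by blast
  next
    case False
    obtain v where v: "u @ v @ w \<in> S"
      using assms(1) u(1) w(1) by (auto simp: recurrent_def)
    have "\<not> prefix x (u @ v @ w) \<and> \<not> prefix (u @ v @ w) x" if "x \<in> X" for x
      using u(2) that by (metis append_prefixD prefixI prefix_same_cases)
    moreover have "\<not> suffix x (u @ v @ w) \<and> \<not> suffix (u @ v @ w) x" if "x \<in> X" for x
      using w(2) that by (metis append.assoc suffix_appendD suffixI suffix_same_cases)
    moreover have "u \<noteq> []" using u(2) False by auto
    ultimately show ?thesis using that[OF v] by blast
  qed
  have "bifix_code (insert y X)"
    using X(2) y by (auto simp: bifix_code_def strict_prefix_def strict_suffix_def)
  moreover have "X \<subset> insert y X" using y by auto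
  moreover have "insert y X \<subseteq> S" using X(1) y(1) by simp
  ultimately show False using X(3) by blast
qed

lemma maximal_bifix_code_complete:
  assumes "recurrent S" "finite X" "maximal_bifix_code_in S X"
  shows "prefix_complete S X" "prefix_complete (rev ` S) (rev ` X)"
proof -
  have X: "bifix_code X" using assms(3) by (simp add: maximal_bifix_code_in_def)
  \<comment> \<open>The converse implication comes from the reversed sets, where reversing twice
    restores \<open>S\<close> and \<open>X\<close>.\<close>
  have "prefix_complete (rev ` S) (rev ` X)" if "prefix_complete S X"
    using suffix_complete_imp_prefix_complete[of "rev ` S" "rev ` X"] assms(1,2) X that
    by (simp add: image_image recurrent_rev bifix_code_rev)
  moreover have "prefix_complete S X" if "prefix_complete (rev ` S) (rev ` X)"
    using suffix_complete_imp_prefix_complete[OF assms(1,2) X that] .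
  moreover note maximal_bifix_code_prefix_or_suffix_complete[OF assms(1,3)]
  ultimately show "prefix_complete S X" "prefix_complete (rev ` S) (rev ` X)"
    by argo+
qed

section \<open>Multiplicities with respect to complete codes\<close>

lemma finite_words: "finite A \<Longrightarrow> finite {z \<in> lists A. length z = n}"
  using finite_lists_length_eq[of A n] by (simp add: lists_eq_set conj_commute Collect_conj_eq Int_commute)

lemma sum_words_Suc:
  assumes "finite A"
  shows "(\<Sum>z | z \<in> lists A \<and> length z = Suc n. g z)
    = (\<Sum>a\<in>A. \<Sum>z | z \<in> lists A \<and> length z = n. g (a # z))"
proof -
  have "(\<Sum>a\<in>A. \<Sum>z | z \<in> lists A \<and> length z = n. g (a # z))
      = (\<Sum>(a, z)\<in>A \<times> {z \<in> lists A. length z = n}. g (a # z))"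
    using assms finite_words by (simp add: sum.cartesian_product)
  also have "\<dots> = (\<Sum>z | z \<in> lists A \<and> length z = Suc n. g z)"
    by (rule sum.reindex_bij_witness[where j = "\<lambda>(a, z). a # z" and i = "\<lambda>z. (hd z, tl z)"])
      (auto simp: length_Suc_conv)
  finally show ?thesis by simp
qed

text \<open>Induction on \<open>n\<close> moves the first letter of \<open>z\<close> into
  \<open>v\<close>. Additivity is assumed at nonempty \<open>v\<close> only: for the
  \<open>\<phi>\<close> built later from a possibly empty \<open>w\<close>, neutrality is applied to
  \<open>w @ v\<close>, which must not be empty.\<close>

lemma additive_sum_words:
  fixes \<phi> :: "'a list \<Rightarrow> int"
  assumes "finite A" "\<And>v. v \<in> lists A \<Longrightarrow> v \<noteq> [] \<Longrightarrow> (\<Sum>a\<in>A. \<phi> (v @ [a])) = \<phi> v"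
    and "v \<in> lists A" "v \<noteq> []"
  shows "(\<Sum>z | z \<in> lists A \<and> length z = n. \<phi> (v @ z)) = \<phi> v"
  using assms(3,4)
proof (induction n arbitrary: v)
  case 0
  have "{z. z \<in> lists A \<and> length z = 0} = {[]}" by auto
  then show ?case by simp
next
  case (Suc n)
  have "(\<Sum>z | z \<in> lists A \<and> length z = n. \<phi> (v @ a # z)) = \<phi> (v @ [a])" if "a \<in> A" for a
    using Suc.IH[of "v @ [a]"] Suc.prems that by simp
  then show ?case
    using Suc.prems assms(1,2) by (simp add: sum_words_Suc)
qed

text \<open>Both sides equal the sum of \<open>\<phi>\<close> over all words of a fixed large length.\<close>

lemma additive_sum_prefix_code:
  fixes \<phi> :: "'a list \<Rightarrow> int"
  assumes "finite A" "finite V" "V \<subseteq> lists A" "[] \<notin> V" "prefix_code V" "prefix_complete S V"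
    and add: "\<And>v. v \<in> lists A \<Longrightarrow> v \<noteq> [] \<Longrightarrow> (\<Sum>a\<in>A. \<phi> (v @ [a])) = \<phi> v"
    and supp: "\<And>v. v \<notin> S \<Longrightarrow> \<phi> v = 0"
  shows "(\<Sum>v\<in>V. \<phi> v) = (\<Sum>a\<in>A. \<phi> [a])"
proof -
  \<comment> \<open>The common length \<open>Suc n\<close> bounds all code words and is positive, so
    that each word of that length also starts with a letter.\<close>
  obtain n where n: "\<And>v. v \<in> V \<Longrightarrow> length v \<le> Suc n"
    using assms(2) by (metis finite_imageI finite_nat_set_iff_bounded_le imageI le_Suc_eq)
  let ?W = "{z \<in> lists A. length z = Suc n}"
  let ?C = "\<lambda>v. {z \<in> ?W. prefix v z}"
  have inner: "(\<Sum>z\<in>?C v. \<phi> z) = \<phi> v" if "v \<in> V" for v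
  proof -
    have "(\<Sum>z\<in>?C v. \<phi> z) = (\<Sum>z | z \<in> lists A \<and> length z = Suc n - length v. \<phi> (v @ z))"
      using that assms(3) n[OF that]
      by (intro sum.reindex_bij_witness[where i = "\<lambda>z. v @ z" and j = "drop (length v)"])
        (auto simp: prefix_def)
    also have "\<dots> = \<phi> v"
      using that assms(1,3,4) add by (intro additive_sum_words) auto
    finally show ?thesis .
  qed
  \<comment> \<open>A word of \<open>S\<close> in \<open>?W\<close> is comparable with some
    \<open>v \<in> V\<close> and at least as long, so it begins with \<open>v\<close>. Uncovered
    words thus lie outside \<open>S\<close>, where \<open>\<phi>\<close> vanishes.\<close>
  have cover: "\<phi> z = 0" if "z \<in> ?W - (\<Union>v\<in>V. ?C v)" for z
  proof (rule ccontr)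
    assume "\<phi> z \<noteq> 0"
    then obtain v where v: "v \<in> V" "prefix v z \<or> prefix z v"
      using supp assms(6) unfolding prefix_complete_def by blast
    moreover have "prefix v z" if "prefix z v"
      using that n[OF v(1)] \<open>z \<in> ?W - _\<close> by (auto simp: prefix_def)
    ultimately show False using \<open>z \<in> ?W - _\<close> by blast
  qed
  have "(\<Sum>v\<in>V. \<phi> v) = (\<Sum>v\<in>V. \<Sum>z\<in>?C v. \<phi> z)"
    using inner by simp
  also have "\<dots> = (\<Sum>z\<in>(\<Union>v\<in>V. ?C v). \<phi> z)"
  proof (rule sum.UNION_disjoint[symmetric])
    show "\<forall>v\<in>V. finite (?C v)"
      by (auto intro: finite_subset[OF _ finite_words[OF assms(1), of "Suc n"]])
    have "v = v'" if "v \<in> V" "v' \<in> V" "prefix v z" "prefix v' z" for v v' z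
      using prefix_same_cases[OF that(3,4)] that(1,2) assms(5) by (auto simp: prefix_code_def)
    then show "\<forall>v\<in>V. \<forall>v'\<in>V. v \<noteq> v' \<longrightarrow> ?C v \<inter> ?C v' = {}"
      by blast
  qed (use assms(2) in auto)
  also have "\<dots> = (\<Sum>z\<in>?W. \<phi> z)"
    using cover finite_words[OF assms(1), of "Suc n"] by (intro sum.mono_neutral_left) auto
  also have "\<dots> = (\<Sum>a\<in>A. \<phi> [a])"
    using additive_sum_words[OF assms(1) add, of "[_]" n] assms(1)
    by (simp add: sum_words_Suc)
  finally show ?thesis .
qed

text \<open>For finite \<open>A\<close> and \<open>U = V = letters A\<close> this is the usual
  multiplicity. Independent sets on the two sides allow letters to be exchanged for code words one
  side at a time.\<close>

definition code_mult :: "'a list set \<Rightarrow> 'a list set \<Rightarrow> 'a list set \<Rightarrow> 'a list \<Rightarrow> int" where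
  "code_mult S U V w = (\<Sum>u\<in>U. \<Sum>v\<in>V. of_bool (u @ w @ v \<in> S))
     - (\<Sum>u\<in>U. of_bool (u @ w \<in> S)) - (\<Sum>v\<in>V. of_bool (w @ v \<in> S)) + 1"

abbreviation letters :: "'a set \<Rightarrow> 'a list set" where
  "letters A \<equiv> (\<lambda>a. [a]) ` A"

lemma sum_letters: "(\<Sum>u\<in>letters A. g u) = (\<Sum>a\<in>A. g [a])"
  by (subst sum.reindex) (auto simp: inj_on_def)

lemma code_mult_rev: "code_mult (rev ` S) (rev ` V) (rev ` U) (rev w) = code_mult S U V w"
proof -
  have "(\<Sum>v\<in>V. \<Sum>u\<in>U. of_bool (u @ w @ v \<in> S)) = (\<Sum>u\<in>U. \<Sum>v\<in>V. of_bool (u @ w @ v \<in> S) :: int)"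
    by (rule sum.swap)
  then show ?thesis
    by (simp add: code_mult_def sum.reindex rev_image_mem_iff)
qed

text \<open>Used twice: \<open>g b = [b]\<close> identifies \<open>word_mult\<close> with
  \<open>code_mult\<close> over letters, and \<open>g b = f [b]\<close> turns multiplicities in the
  preimage into multiplicities over \<open>X\<close>.\<close>

lemma word_mult_preimage:
  assumes "finite B" "inj_on g B" "\<And>b. b \<in> B \<Longrightarrow> [b] @ w \<in> T \<longleftrightarrow> g b @ w' \<in> S"
    "\<And>b. b \<in> B \<Longrightarrow> w @ [b] \<in> T \<longleftrightarrow> w' @ g b \<in> S"
    "\<And>b c. b \<in> B \<Longrightarrow> c \<in> B \<Longrightarrow> [b] @ w @ [c] \<in> T \<longleftrightarrow> g b @ w' @ g c \<in> S"
  shows "word_mult B T w = code_mult S (g ` B) (g ` B) w'"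
proof -
  have "int (card {a \<in> B. [a] @ w \<in> T}) = (\<Sum>a\<in>B. of_bool (g a @ w' \<in> S))"
    using assms(1,3) by (subst sum_of_bool_eq) (auto intro!: arg_cong[where f = card])
  moreover have "int (card {a \<in> B. w @ [a] \<in> T}) = (\<Sum>a\<in>B. of_bool (w' @ g a \<in> S))"
    using assms(1,4) by (subst sum_of_bool_eq) (auto intro!: arg_cong[where f = card])
  moreover have "int (card {(a, b) \<in> B \<times> B. [a] @ w @ [b] \<in> T})
      = (\<Sum>a\<in>B. \<Sum>b\<in>B. of_bool (g a @ w' @ g b \<in> S))"
  proof -
    have "(\<Sum>a\<in>B. \<Sum>b\<in>B. of_bool (g a @ w' @ g b \<in> S))
        = (\<Sum>p\<in>B \<times> B. of_bool (g (fst p) @ w' @ g (snd p) \<in> S) :: int)"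
      by (simp add: sum.cartesian_product case_prod_beta)
    also have "\<dots> = int (card {(a, b) \<in> B \<times> B. [a] @ w @ [b] \<in> T})"
      using assms(1,5) by (subst sum_of_bool_eq) (auto intro!: arg_cong[where f = card])
    finally show ?thesis by simp
  qed
  ultimately show ?thesis
    using assms(2)
    by (simp add: word_mult_def bi_ext_card_def left_ext_card_def right_ext_card_def
        code_mult_def sum.reindex)
qed

lemma code_mult_right:
  assumes "finite A" "S \<subseteq> lists A" "factorial S"
    and "finite V" "V \<subseteq> lists A" "[] \<notin> V" "prefix_code V" "prefix_complete S V"
    and zero: "\<And>w. w \<in> S \<Longrightarrow> w \<noteq> [] \<Longrightarrow> code_mult S U (letters A) w = 0"
  shows "code_mult S U V w = code_mult S U (letters A) w"
proof -
  define \<phi> :: "'a list \<Rightarrow> int" where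
    "\<phi> v = (\<Sum>u\<in>U. of_bool (u @ w @ v \<in> S)) - of_bool (w @ v \<in> S)" for v
  have factor: "y \<in> S" if "x @ y @ z \<in> S" for x y z
    using assms(3) that unfolding factorial_def sublist_def by blast
  \<comment> \<open>If \<open>w @ v \<in> S\<close>, the two sides differ by
    \<open>code_mult S U (letters A) (w @ v)\<close>, which is zero; otherwise every term vanishes
    because \<open>S\<close> is factorial.\<close>
  have add: "(\<Sum>a\<in>A. \<phi> (v @ [a])) = \<phi> v" if "v \<noteq> []" for v
  proof (cases "w @ v \<in> S")
    case True
    have "(\<Sum>a\<in>A. \<Sum>u\<in>U. of_bool (u @ w @ v @ [a] \<in> S))
        = (\<Sum>u\<in>U. \<Sum>a\<in>A. of_bool (u @ w @ v @ [a] \<in> S) :: int)"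
      by (rule sum.swap)
    then show ?thesis
      using zero[OF True] that True by (simp add: code_mult_def \<phi>_def sum_letters sum_subtractf)
  next
    case False
    then have "u @ w @ v \<notin> S" "w @ v @ z \<notin> S" "u @ w @ v @ z \<notin> S" for u z
      using factor[of u "w @ v" "[]"] factor[of "[]" "w @ v" z] factor[of u "w @ v" z] by auto
    then show ?thesis using False by (simp add: \<phi>_def)
  qed
  have supp: "\<phi> v = 0" if "v \<notin> S" for v
  proof -
    have "u @ w @ v \<notin> S" "w @ v \<notin> S" for u
      using factor[of "u @ w" v "[]"] factor[of w v "[]"] that by auto
    then show ?thesis by (simp add: \<phi>_def)
  qed
  \<comment> \<open>Only the sum of \<open>\<phi>\<close> depends on the right-hand set
    \<open>Y\<close>.\<close>
  have split: "code_mult S U Y w = (\<Sum>v\<in>Y. \<phi> v) - (\<Sum>u\<in>U. of_bool (u @ w \<in> S)) + 1" for Y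
    using sum.swap[of "\<lambda>u v. of_bool (u @ w @ v \<in> S) :: int" Y U]
    by (simp add: code_mult_def \<phi>_def sum_subtractf)
  have "(\<Sum>v\<in>V. \<phi> v) = (\<Sum>v\<in>letters A. \<phi> v)"
    using additive_sum_prefix_code[OF assms(1,4-8) add supp] by (simp add: sum_letters)
  then show ?thesis by (simp add: split)
qed

text \<open>The right side is exchanged first, then the left side through reversal. The second
  exchange needs multiplicities with letters on the left and \<open>X\<close> on the right to
  vanish, which the first one supplies.\<close>

lemma code_mult_eq_letters:
  assumes "finite A" "S \<subseteq> lists A" "factorial S"
    and "finite X" "X \<subseteq> lists A" "bifix_code X"
    and "prefix_complete S X" "prefix_complete (rev ` S) (rev ` X)"
    and zero: "\<And>w. w \<in> S \<Longrightarrow> w \<noteq> [] \<Longrightarrow> code_mult S (letters A) (letters A) w = 0"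
  shows "code_mult S X X w = code_mult S (letters A) (letters A) w"
proof -
  have "[] \<notin> X" using assms(6) by (simp add: bifix_code_def)
  have rev_letters: "rev ` letters A = letters A"
    by (simp add: image_image)
  have right: "code_mult S (letters A) X v = code_mult S (letters A) (letters A) v" for v
    using assms \<open>[] \<notin> X\<close> by (intro code_mult_right) (auto intro: bifix_code_imp_prefix_code)
  have rev_mult: "code_mult (rev ` S) (rev ` X) (letters A) v = code_mult S (letters A) X (rev v)" for v
    using code_mult_rev[of S X "letters A" "rev v"] rev_letters by simp
  have "code_mult S X X w = code_mult (rev ` S) (rev ` X) (rev ` X) (rev w)"
    by (simp add: code_mult_rev)
  also have "\<dots> = code_mult (rev ` S) (rev ` X) (letters A) (rev w)"
  proof (rule code_mult_right)
    show "rev ` S \<subseteq> lists A" "rev ` X \<subseteq> lists A"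
      using assms(2,5) by (auto simp: subset_iff)
    show "prefix_code (rev ` X)"
      using assms(6) by (intro bifix_code_imp_prefix_code bifix_code_rev)
    show "code_mult (rev ` S) (rev ` X) (letters A) v = 0" if "v \<in> rev ` S" "v \<noteq> []" for v
      using that zero by (simp add: rev_mult right rev_image_mem_iff)
  qed (use assms \<open>[] \<notin> X\<close> factorial_rev in auto)
  finally show ?thesis by (simp add: rev_mult right)
qed

section \<open>Maximal bifix decoding\<close>

theorem theorem4:
  fixes A :: "'a set" and B :: "'b set"
    and S X :: "'a list set" and f :: "'b list \<Rightarrow> 'a list"
  assumes "finite A"
    and "S \<subseteq> lists A"
    and "recurrent S"
    and "neutral A S"
    and "finite X"
    and "maximal_bifix_code_in S X"
    and "coding_morphism B A X f"
  shows "neutral B (f -` S \<inter> lists B)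
    \<and> characteristic B (f -` S \<inter> lists B) = characteristic A S"
proof -
  let ?T = "f -` S \<inter> lists B"
  have S: "factorial S" "\<And>w. w \<in> S \<Longrightarrow> w \<noteq> [] \<Longrightarrow> word_mult A S w = 0"
    using assms(4) by (auto simp: neutral_def)
  have X: "X \<subseteq> S" "bifix_code X"
    using assms(6) by (auto simp: maximal_bifix_code_in_def)
  have f: "f [] = []" "\<And>u v. u \<in> lists B \<Longrightarrow> v \<in> lists B \<Longrightarrow> f (u @ v) = f u @ f v"
    and bij: "bij_betw (\<lambda>b. f [b]) B X"
    using assms(7) by (auto simp: coding_morphism_def word_morphism_def)
  have B: "finite B" "inj_on (\<lambda>b. f [b]) B" "(\<lambda>b. f [b]) ` B = X"
    using bij assms(5) by (auto simp: bij_betw_finite bij_betw_def)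
  have multA: "word_mult A S w = code_mult S (letters A) (letters A) w" for w
    using assms(1) by (intro word_mult_preimage) (auto simp: inj_on_def)
  \<comment> \<open>This includes the empty word, whose case gives the equality of
    characteristics.\<close>
  have multB: "word_mult B ?T w = word_mult A S (f w)" if w: "w \<in> lists B" for w
  proof -
    have "word_mult B ?T w = code_mult S ((\<lambda>b. f [b]) ` B) ((\<lambda>b. f [b]) ` B) (f w)"
    proof (rule word_mult_preimage[OF B(1,2)])
      fix b c assume bc: "b \<in> B" "c \<in> B"
      have "f ([b] @ w @ [c]) = f [b] @ f w @ f [c]"
        using w bc f(2)[of "[b]" "w @ [c]"] f(2)[of w "[c]"] by simp
      then show "[b] @ w @ [c] \<in> ?T \<longleftrightarrow> f [b] @ f w @ f [c] \<in> S"
        using w bc by simp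
    next
      fix b assume "b \<in> B"
      then show "[b] @ w \<in> ?T \<longleftrightarrow> f [b] @ f w \<in> S" "w @ [b] \<in> ?T \<longleftrightarrow> f w @ f [b] \<in> S"
        using w f(2)[of "[b]" w] f(2)[of w "[b]"] by simp_all
    qed
    also have "\<dots> = code_mult S (letters A) (letters A) (f w)"
      unfolding B(3)
      using assms(1,2,5) S X multA maximal_bifix_code_complete[OF assms(3,5,6)]
      by (intro code_mult_eq_letters) auto
    finally show ?thesis by (simp add: multA)
  qed
  have "factorial ?T"
    unfolding factorial_def
  proof (intro ballI allI impI)
    fix w u assume w: "w \<in> ?T" and "sublist u w"
    then obtain p s where ps: "w = p @ u @ s" by (auto simp: sublist_def)
    then have "p \<in> lists B" "u \<in> lists B" "s \<in> lists B" using w by auto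
    then have "f w = f p @ f u @ f s" using f(2) ps by simp
    then have "f u \<in> S"
      using w S(1) unfolding factorial_def by (metis IntE sublist_appendI vimageE)
    then show "u \<in> ?T" using \<open>u \<in> lists B\<close> by simp
  qed
  moreover have "word_mult B ?T w = 0" if w: "w \<in> ?T" "w \<noteq> []" for w
  proof -
    \<comment> \<open>Neutrality of \<open>S\<close> concerns nonempty words only;
      \<open>f w\<close> is nonempty because it begins with a code word.\<close>
    obtain b v where bv: "w = [b] @ v" using w(2) by (cases w) auto
    then have "f w = f [b] @ f v" "f [b] \<in> X"
      using w(1) f(2)[of "[b]" v] B(3) by auto
    then have "f w \<noteq> []" using X(2) by (auto simp: bifix_code_def)
    then show ?thesis using w(1) multB S(2) by simp
  qed
  ultimately show ?thesis
    using multB[of "[]"] f(1) by (simp add: neutral_def characteristic_def)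
qed

end
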